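(* Let $k>1$ be an integer and let $q$ be a power of an odd prime $p$. If the map $Q_{A_1}^k:\mathbf{F}_q\to\mathbf{F}_q$ is a permutation, then $p\le\left(\frac{k+1}{2}\right)^2+1$. Moreover, $Q_{A_1}^k$ is not arithmetically exceptional.
   Context: $\mathbf{F}_q$ is the finite field with $q$ elements. A polynomial $f\in\mathbf{Z}[x]$ is called arithmetically exceptional if the induced map $f:\mathbf{F}_p\to\mathbf{F}_p$ is a permutation for infinitely many primes $p$. The polynomials $Q_{A_1}^k\in\mathbf{Z}[x]$ (Chebyshev/Dickson polynomials of the second kind) are defined by $Q_{A_1}^k\left(y+\frac1y\right)=\frac{y^{k+1}-y^{-(k+1)}}{y-y^{-1}}$; equivalently $Q^0_{A_1}=1$, $Q^1_{A_1}=x$, $Q^k_{A_1}=xQ^{k-1}_{A_1}-Q^{k-2}_{A_1}$ for $k\ge2$. *)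

theory Defs
  imports
    "HOL-Computational_Algebra.Polynomial"
    "HOL-Computational_Algebra.Primes"
    "HOL-Number_Theory.Residues"
begin

fun Q_A1 :: "nat \<Rightarrow> int poly" where
  "Q_A1 0 = 1"
| "Q_A1 (Suc 0) = [:0, 1:]"
| "Q_A1 (Suc (Suc k)) = [:0, 1:] * Q_A1 (Suc k) - Q_A1 k"

lemma Q_A1_functional_equation:
  fixes y :: "'a :: field"
  assumes "y \<noteq> 0"
  shows "poly (map_poly of_int (Q_A1 k)) (y + 1 / y) * (y - 1 / y) = y ^ (k + 1) - 1 / y ^ (k + 1)"
proof -
  have ev: "poly (map_poly of_int (Q_A1 (Suc (Suc k)))) x =
      x * poly (map_poly of_int (Q_A1 (Suc k))) x - poly (map_poly of_int (Q_A1 k)) x"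
    for x :: 'a and k
  proof -
    have "map_poly of_int (Q_A1 (Suc (Suc k))) =
        pCons 0 (map_poly of_int (Q_A1 (Suc k))) - (map_poly of_int (Q_A1 k) :: 'a poly)"
      by (rule poly_eqI) (simp add: coeff_map_poly coeff_pCons split: nat.split)
    then show ?thesis by simp
  qed
  show ?thesis
  proof (induction k rule: Q_A1.induct)
    case 1
    then show ?case by simp
  next
    case 2
    then show ?case using assms by (simp add: map_poly_pCons field_simps power2_eq_square)
  next
    case (3 k)
    have "poly (map_poly of_int (Q_A1 (Suc (Suc k)))) (y + 1 / y) * (y - 1 / y) =
        (y + 1 / y) * (poly (map_poly of_int (Q_A1 (Suc k))) (y + 1 / y) * (y - 1 / y))
        - poly (map_poly of_int (Q_A1 k)) (y + 1 / y) * (y - 1 / y)"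
      unfolding ev by (simp only: left_diff_distrib mult.assoc)
    also have "\<dots> = (y + 1 / y) * (y ^ (Suc k + 1) - 1 / y ^ (Suc k + 1))
        - (y ^ (k + 1) - 1 / y ^ (k + 1))"
      using 3 by simp
    also have "\<dots> = y ^ (Suc (Suc k) + 1) - 1 / y ^ (Suc (Suc k) + 1)"
      using assms by (simp add: field_simps)
    finally show ?case .
  qed
qed

text \<open>
  Rings are explicit carriers here because the definition of arithmetic exceptionality
  quantifies over the size of the field.
\<close>

definition induced_map :: "('a, 'b) ring_scheme \<Rightarrow> int poly \<Rightarrow> 'a \<Rightarrow> 'a" where
  "induced_map R f x =
    (\<Oplus>\<^bsub>R\<^esub>i\<in>{..Polynomial.degree f}. ([Polynomial.coeff f i] \<cdot>\<^bsub>R\<^esub> \<one>\<^bsub>R\<^esub>) \<otimes>\<^bsub>R\<^esub> (x [^]\<^bsub>R\<^esub> i))"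

definition induces_permutation :: "('a, 'b) ring_scheme \<Rightarrow> int poly \<Rightarrow> bool" where
  "induces_permutation R f \<longleftrightarrow> bij_betw (induced_map R f) (carrier R) (carrier R)"

definition arithmetically_exceptional :: "int poly \<Rightarrow> bool" where
  "arithmetically_exceptional f \<longleftrightarrow>
    infinite {p :: nat. prime p \<and> induces_permutation (residue_ring (int p)) f}"

lemma (in residues) add_pow_one_eq: "[c] \<cdot> \<one> = (c :: int) mod m"
proof -
  have nat: "[n] \<cdot> \<one> = int n mod m" for n :: nat
  proof (induction n)
    case 0
    then show ?case using res_zero_eq by simp
  next
    case (Suc n)
    have "[Suc n] \<cdot> \<one> = [n] \<cdot> \<one> \<oplus> \<one>"
      by (rule add.nat_pow_Suc)
    then show ?case using Suc
      by (simp add: res_add_eq res_one_eq mod_simps add.commute)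
  qed
  show ?thesis
  proof (cases "c \<ge> 0")
    case True
    then show ?thesis using nat[of "nat c"] add_pow_int_ge[of c R \<one>] by simp
  next
    case False
    then have "[c] \<cdot> \<one> = \<ominus> ([nat (- c)] \<cdot> \<one>)"
      using add_pow_int_lt[of c R \<one>] by simp
    then show ?thesis using nat[of "nat (- c)"] False
      by (simp add: res_neg_eq mod_simps)
  qed
qed

lemma (in residues) induced_map_eq:
  assumes "x \<in> carrier R"
  shows "induced_map R f x = poly f x mod m"
proof -
  have x: "x mod m = x"
    using assms by (simp add: res_carrier_eq)
  have "induced_map R f x = (\<Oplus>i\<in>{..Polynomial.degree f}. (Polynomial.coeff f i * x ^ i) mod m)"
    unfolding induced_map_def
  proof (rule finsum_cong')
    fix i
    have "x [^] i = x ^ i mod m"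
      using pow_cong[of x i] x by simp
    then show "([Polynomial.coeff f i] \<cdot> \<one>) \<otimes> (x [^] i) = (Polynomial.coeff f i * x ^ i) mod m"
      by (simp add: add_pow_one_eq mult_cong)
  qed auto
  also have "\<dots> = (\<Sum>i\<le>Polynomial.degree f. Polynomial.coeff f i * x ^ i) mod m"
    by (rule sum_cong) simp
  finally show ?thesis by (simp add: poly_altdef)
qed

end

theory Submission
  imports Defs
begin

text \<open>
  Only the prime field matters: an integer polynomial that permutes a field of characteristic
  \<open>p\<close> maps the copy of \<open>\<int>/p\<close> in it to itself, so it is injective modulo \<open>p\<close>
  (\<open>induces_permutation_imp_injective_mod\<close>). It therefore suffices that \<open>Q_A1 k\<close> is not injective
  modulo an odd prime \<open>p \<ge> 2 * k\<close> (\<open>Q_A1_not_injective_mod\<close>). This yields \<open>p \<le> 2 * k - 1\<close> for a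
  permutation, which is at most \<open>((k + 1) / 2)\<^sup>2 + 1\<close> because the difference is \<open>((k - 3) / 2)\<^sup>2\<close>; and
  it leaves only finitely many primes for arithmetic exceptionality.

  For even \<open>k\<close> the polynomial is even and takes the same value at \<open>1\<close> and \<open>- 1\<close>. For odd \<open>k\<close> the
  argument is Hermite's criterion. If \<open>Q_A1 k\<close> permuted \<open>\<int>/p\<close>, then for \<open>0 < n < p - 1\<close> the sum of
  its \<open>n\<close>-th powers over all residues would be the sum of \<open>x ^ n\<close>, which vanishes modulo \<open>p\<close>.
  Take for \<open>n\<close> the least even number with \<open>n * k \<ge> p - 1\<close> and write \<open>n * k = p - 1 + 2 * s\<close>, so that
  \<open>s < k\<close>. Expand the \<open>n\<close>-th power in the Chebyshev polynomials \<open>U j\<close> themselves (\<open>Q_A1_power\<close>):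
  multiplication by \<open>Q_A1 k\<close> replaces \<open>U j\<close> by the sum of \<open>U (j + k - 2 * l)\<close> over \<open>l \<le> k\<close>, so the
  coefficient of \<open>U (n * k - 2 * i)\<close> can be taken to be that of \<open>z ^ i\<close> in
  \<open>(1 + z + \<dots> + z ^ k) ^ (n - 1)\<close>. Among the \<open>U j\<close> that occur, only \<open>U (p - 1)\<close> has a value sum that
  is nonzero modulo \<open>p\<close> (\<open>sum_U_cong\<close>), namely \<open>- 1\<close>. Its index is \<open>i = s\<close>, and since \<open>s \<le> k\<close> the
  truncation of the geometric series is not felt there: the coefficient is \<open>(n - 2 + s) choose s\<close>.
  As \<open>n - 2 + s < p\<close>, this binomial coefficient is prime to \<open>p\<close>, a contradiction.
\<close>

section \<open>Sums of polynomial values over a prime field\<close>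

text \<open>
  Telescoping \<open>(x + 1) ^ (j + 1) - x ^ (j + 1)\<close> over \<open>x < p\<close> gives \<open>p ^ (j + 1)\<close>. Expanded by the binomial
  theorem it is \<open>j + 1\<close> times the \<open>j\<close>-th power sum plus a combination of the lower ones, and \<open>j + 1\<close> is
  invertible modulo \<open>p\<close>.
\<close>

lemma power_sum_cong_0:
  fixes p j :: nat
  assumes "prime p" "j < p - 1"
  shows "int p dvd (\<Sum>x<p. int x ^ j)"
  using assms(2)
proof (induction j rule: less_induct)
  case (less j)
  let ?S = "\<lambda>i. \<Sum>x<p. int x ^ i"
  have expand: "(int x + 1) ^ Suc j - int x ^ Suc j = (\<Sum>i\<le>j. int (Suc j choose i) * int x ^ i)" for x
    by (subst binomial_ring) simp
  have "int p ^ Suc j = (\<Sum>x<p. (int x + 1) ^ Suc j - int x ^ Suc j)"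
    using sum_lessThan_telescope[of "\<lambda>x. int x ^ Suc j" p] by (simp add: add.commute)
  also have "\<dots> = (\<Sum>i\<le>j. int (Suc j choose i) * ?S i)"
    unfolding expand by (subst sum.swap) (simp add: sum_distrib_left)
  also have "\<dots> = (\<Sum>i<j. int (Suc j choose i) * ?S i) + int (Suc j) * ?S j"
    by (simp add: lessThan_Suc_atMost[symmetric])
  finally have eq: "int p ^ Suc j = (\<Sum>i<j. int (Suc j choose i) * ?S i) + int (Suc j) * ?S j" .
  have "int p dvd (\<Sum>i<j. int (Suc j choose i) * ?S i)"
  proof (rule dvd_sum, rule dvd_mult)
    fix i assume "i \<in> {..<j}"
    then show "int p dvd ?S i"
      using less by simp
  qed
  moreover have "int p dvd int p ^ Suc j"
    by simp
  ultimately have "int p dvd int (Suc j) * ?S j"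
    unfolding eq using dvd_add_right_iff by blast
  moreover have "\<not> int p dvd int (Suc j)"
    unfolding int_dvd_int_iff using less.prems by (intro nat_dvd_not_less) auto
  moreover have "prime (int p)"
    using assms(1) by simp
  ultimately show ?case
    using prime_dvd_mult_iff by blast
qed

text \<open>
  By Fermat's theorem the exponent may be lowered by \<open>p - 1\<close> at the nonzero residues. At
  \<open>j = p - 1\<close> the lowered power is \<open>0 ^ 0 = 1\<close> at \<open>x = 0\<close> too, while the original is \<open>0\<close>;
  this accounts for the value \<open>- 1\<close>.
\<close>

lemma power_sum_cong:
  fixes p j :: nat
  assumes "prime p" "j < 2 * (p - 1)"
  shows "[(\<Sum>x<p. int x ^ j) = (if j = p - 1 then - 1 else 0)] (mod int p)"
proof (cases "j < p - 1")
  case True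
  then show ?thesis
    using power_sum_cong_0[OF assms(1)] by (simp add: cong_0_iff)
next
  case False
  define i where "i = j - (p - 1)"
  have j: "j = i + (p - 1)" and i: "i < p - 1"
    using False assms(2) by (auto simp: i_def)
  have p: "p > 1" using assms(1) by (rule prime_gt_1_nat)
  have fermat: "[int x ^ (p - 1) = 1] (mod int p)" if "x \<in> {1..<p}" for x
  proof -
    have "\<not> p dvd x"
      using that by (auto dest: dvd_imp_le)
    from fermat_theorem[OF assms(1) this] show ?thesis
      by (metis cong_int_iff of_nat_1 of_nat_power)
  qed
  have split: "{..<p} = insert 0 {1..<p}"
    using p by auto
  have "(\<Sum>x<p. int x ^ j) = (\<Sum>x\<in>{1..<p}. int x ^ j)"
    unfolding split using False p by (simp add: power_0_left)
  also have "[\<dots> = (\<Sum>x\<in>{1..<p}. int x ^ i)] (mod int p)"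
    unfolding j power_add
    by (intro cong_sum) (metis cong_scalar_left fermat mult.right_neutral)
  also have "(\<Sum>x\<in>{1..<p}. int x ^ i) = (\<Sum>x<p. int x ^ i) - 0 ^ i"
    unfolding split by simp
  also have "[\<dots> = 0 - 0 ^ i] (mod int p)"
    using power_sum_cong_0[OF assms(1) i] by (intro cong_diff) (simp_all add: cong_0_iff)
  finally show ?thesis
    using j by (auto simp: power_0_left)
qed

lemma sum_poly_cong_coeff:
  fixes f :: "int poly"
  assumes "prime p" "Polynomial.degree f < 2 * (p - 1)"
  shows "[(\<Sum>x<p. poly f (int x)) = - Polynomial.coeff f (p - 1)] (mod int p)"
proof -
  let ?d = "Polynomial.degree f" and ?c = "Polynomial.coeff f"
  have "(\<Sum>x<p. poly f (int x)) = (\<Sum>j\<le>?d. ?c j * (\<Sum>x<p. int x ^ j))"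
    unfolding poly_altdef by (subst sum.swap) (simp add: sum_distrib_left)
  also have "[\<dots> = (\<Sum>j\<le>?d. ?c j * (if j = p - 1 then - 1 else 0))] (mod int p)"
    using assms by (intro cong_sum cong_scalar_left power_sum_cong) auto
  also have "(\<Sum>j\<le>?d. ?c j * (if j = p - 1 then - 1 else 0)) = - ?c (p - 1)"
    by (simp add: if_distrib[of "\<lambda>a. _ * a"] coeff_eq_0 cong: if_cong)
  finally show ?thesis .
qed

section \<open>Chebyshev polynomials of the second kind with integer index\<close>

lemma degree_Q_A1: "Polynomial.degree (Q_A1 j) \<le> j"
proof (induction j rule: Q_A1.induct)
  case (3 k)
  have "Polynomial.degree ([:0, 1:] * Q_A1 (Suc k)) \<le> Suc (Suc k)"
    using 3 by (intro order.trans[OF degree_mult_le]) simp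
  then show ?case
    using 3 by (simp only: Q_A1.simps) (intro degree_diff_le, auto)
qed auto

lemma coeff_Q_A1_Suc_Suc:
  "Polynomial.coeff (Q_A1 (Suc (Suc k))) a =
     (case a of 0 \<Rightarrow> 0 | Suc b \<Rightarrow> Polynomial.coeff (Q_A1 (Suc k)) b) - Polynomial.coeff (Q_A1 k) a"
  by (simp add: coeff_pCons)

lemma coeff_Q_A1_gt: "j < a \<Longrightarrow> Polynomial.coeff (Q_A1 j) a = 0"
  by (intro coeff_eq_0 le_less_trans[OF degree_Q_A1])

lemma coeff_Q_A1_odd: "odd (j + a) \<Longrightarrow> Polynomial.coeff (Q_A1 j) a = 0"
proof (induction j arbitrary: a rule: Q_A1.induct)
  case 1
  then show ?case by (cases a) auto
next
  case 2
  then show ?case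
    by (cases "a = 0") (auto simp: coeff_pCons elim: oddE split: nat.split)
next
  case (3 k)
  show ?case
  proof (cases a)
    case 0
    then show ?thesis
      using 3 by (simp only: coeff_Q_A1_Suc_Suc) simp
  next
    case (Suc b)
    then have "Polynomial.coeff (Q_A1 (Suc k)) b = 0" "Polynomial.coeff (Q_A1 k) a = 0"
      using 3 by simp_all
    then show ?thesis
      using Suc by (simp only: coeff_Q_A1_Suc_Suc) simp
  qed
qed

lemma coeff_Q_A1:
  "Polynomial.coeff (Q_A1 (a + 2 * i)) a = (- 1) ^ i * int ((a + i) choose a)"
proof (induction i arbitrary: a)
  case 0
  have "Polynomial.coeff (Q_A1 a) a = 1"
    by (induction a rule: Q_A1.induct) (simp_all add: coeff_Q_A1_gt)
  then show ?case by simp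
next
  case (Suc i)
  note IH = Suc.IH
  show ?case
  proof (induction a)
    case 0
    show ?case
      using Suc[of 0] by (simp only: mult_Suc_right add_2_eq_Suc add_0 coeff_Q_A1_Suc_Suc nat.case) simp
  next
    case (Suc b)
    have "Polynomial.coeff (Q_A1 (Suc b + 2 * Suc i)) (Suc b) =
        Polynomial.coeff (Q_A1 (b + 2 * Suc i)) b - Polynomial.coeff (Q_A1 (Suc b + 2 * i)) (Suc b)"
      using coeff_Q_A1_Suc_Suc[of "Suc b + 2 * i" "Suc b"] by simp
    also have "\<dots> = (- 1) ^ Suc i * (int ((b + Suc i) choose b) + int ((b + Suc i) choose Suc b))"
      unfolding Suc IH
      by (simp add: algebra_simps)
    also have "\<dots> = (- 1) ^ Suc i * int ((Suc b + Suc i) choose Suc b)"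
      by simp
    finally show ?case .
  qed
qed

text \<open>
  For \<open>j = p - 1 + 2 * i\<close> with \<open>0 < i\<close>, the coefficient is up to sign \<open>(p - 1 + i) choose i\<close>, whose
  numerator \<open>p * (p + 1) * \<dots> * (p - 1 + i)\<close> contains \<open>p\<close> while its denominator, the factorial of
  \<open>i < p\<close>, does not.
\<close>

lemma coeff_Q_A1_prime:
  fixes p j :: nat
  assumes p: "prime p" and j: "j < 2 * (p - 1)"
  shows "[Polynomial.coeff (Q_A1 j) (p - 1) = (if j = p - 1 then 1 else 0)] (mod int p)"
proof -
  consider "j < p - 1" | "odd (j + (p - 1))" | i where "j = p - 1 + 2 * i"
    by (metis add.commute dvd_def even_add le_add_diff_inverse not_le even_diff_nat)
  then show ?thesis
  proof cases
    case 1
    then show ?thesis by (simp add: coeff_Q_A1_gt)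
  next
    case 2
    then show ?thesis by (auto simp: coeff_Q_A1_odd)
  next
    case (3 i)
    show ?thesis
    proof (cases "i = 0")
      case True
      then show ?thesis using coeff_Q_A1[of "p - 1" 0] 3 by simp
    next
      case False
      have i: "i < p"
        using 3 j by linarith
      have "i * (p - 1 + i choose i) = (p - 1 + i) * (p - 1 + i - 1 choose (i - 1))"
        using False by (intro times_binomial_minus1_eq) simp
      also have "\<dots> = (p - 1 + i - (i - 1)) * (p - 1 + i choose (i - 1))"
        by (rule binomial_absorb_comp[symmetric])
      also have "p - 1 + i - (i - 1) = p"
        using False i by simp
      finally have "p dvd i * (p - 1 + i choose i)"
        by simp
      moreover have "\<not> p dvd i"
        using i False by (auto dest: dvd_imp_le)
      ultimately have "p dvd (p - 1 + i choose i)"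
        using p prime_dvd_mult_iff by blast
      then have "p dvd (p - 1 + i choose (p - 1))"
        using binomial_symmetric[of i "p - 1 + i"] by simp
      then show ?thesis
        unfolding 3 coeff_Q_A1 using False by (simp add: cong_0_iff)
    qed
  qed
qed

text \<open>
  The extension of the recurrence to all integer indices. In terms of \<open>x = y + 1 / y\<close>, the product of
  \<open>U j\<close> with \<open>y - 1 / y\<close> is \<open>y powi (j + 1) - y powi (- (j + 1))\<close> for every \<open>j\<close>, hence the
  antisymmetry about \<open>- 1\<close>. It lets the product rule below hold without a case distinction on whether
  \<open>j < k\<close>.
\<close>

definition U :: "int \<Rightarrow> int poly" where
  "U j = (if j \<ge> 0 then Q_A1 (nat j) else if j = - 1 then 0 else - Q_A1 (nat (- j - 2)))"

lemma U_of_nat [simp]: "U (int j) = Q_A1 j"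
  by (simp add: U_def)

lemma U_reflect: "U (- j - 2) = - U j"
  by (auto simp: U_def)

lemma U_recurrence: "[:0, 1:] * U j = U (j + 1) + U (j - 1)"
proof -
  have nonneg: "[:0, 1:] * U (int n) = U (int n + 1) + U (int n - 1)" for n
  proof (cases n)
    case 0
    then show ?thesis by (simp add: U_def)
  next
    case (Suc i)
    then have "int n + 1 = int (Suc (Suc i))" "int n - 1 = int i"
      by simp_all
    then have "U (int n + 1) = Q_A1 (Suc (Suc i))" "U (int n - 1) = Q_A1 i"
      by (simp_all only: U_of_nat)
    then show ?thesis
      unfolding U_of_nat Suc Q_A1.simps by simp
  qed
  consider "j \<ge> 0" | "j = - 1" | "j \<le> - 2"
    by linarith
  then show ?thesis
  proof cases
    case 1
    then show ?thesis using nonneg[of "nat j"] by simp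
  next
    case 2
    then show ?thesis by (simp add: U_def)
  next
    case 3
    have "U (- j - 2 + 1) = - U (j - 1)" "U (- j - 2 - 1) = - U (j + 1)"
      using U_reflect[of "j - 1"] U_reflect[of "j + 1"] by (simp_all add: algebra_simps)
    then show ?thesis
      using nonneg[of "nat (- j - 2)"] 3 arg_cong[of _ _ uminus] by (fastforce simp: U_reflect)
  qed
qed

text \<open>
  The Clebsch--Gordan rule for characters of \<open>SL(2)\<close>: in terms of \<open>y\<close>, the polynomial \<open>Q_A1 k\<close> is the
  sum of \<open>y powi (k - 2 * l)\<close> over \<open>l \<le> k\<close>, and multiplication by such a symmetric sum shifts the
  index of \<open>U j\<close> by each of its exponents.
\<close>

lemma Q_A1_times_U: "Q_A1 k * U j = (\<Sum>l\<le>k. U (j + int k - 2 * int l))"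
proof (induction k rule: Q_A1.induct)
  case 1
  then show ?case by simp
next
  case 2
  then show ?case using U_recurrence[of j] by simp
next
  case (3 k)
  have "Q_A1 (Suc (Suc k)) * U j = [:0, 1:] * (Q_A1 (Suc k) * U j) - Q_A1 k * U j"
    by (simp only: Q_A1.simps left_diff_distrib mult.assoc)
  also have "[:0, 1:] * (Q_A1 (Suc k) * U j) =
      (\<Sum>l\<le>Suc k. U (j + int k + 2 - 2 * int l)) + (\<Sum>l\<le>Suc k. U (j + int k - 2 * int l))"
    unfolding 3 sum_distrib_left U_recurrence sum.distrib by (simp add: algebra_simps)
  also have "\<dots> - Q_A1 k * U j =
      (\<Sum>l\<le>Suc k. U (j + int k + 2 - 2 * int l)) + U (j + int k - 2 * int (Suc k))"
    unfolding 3 by simp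
  also have "\<dots> = (\<Sum>l\<le>Suc (Suc k). U (j + int (Suc (Suc k)) - 2 * int l))"
    by (simp add: algebra_simps)
  finally show ?case .
qed

definition geom_poly :: "nat \<Rightarrow> int poly" where
  "geom_poly k = (\<Sum>l\<le>k. Polynomial.monom 1 l)"

text \<open>
  The index drops by \<open>2\<close> for each factor \<open>z\<close> in the polynomial \<open>g\<close>. With this bookkeeping,
  multiplication by \<open>Q_A1 k\<close> becomes multiplication of \<open>g\<close> by \<open>1 + z + \<dots> + z ^ k\<close> together with a
  shift of the starting index \<open>d\<close>.
\<close>

definition U_sum :: "int \<Rightarrow> int poly \<Rightarrow> int poly" where
  "U_sum d g = (\<Sum>i\<le>Polynomial.degree g. Polynomial.smult (Polynomial.coeff g i) (U (d - 2 * int i)))"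

lemma U_sum_bound:
  assumes "Polynomial.degree g \<le> n"
  shows "U_sum d g = (\<Sum>i\<le>n. Polynomial.smult (Polynomial.coeff g i) (U (d - 2 * int i)))"
  unfolding U_sum_def using assms by (intro sum.mono_neutral_left) (auto simp: coeff_eq_0)

lemma U_sum_add: "U_sum d (f + g) = U_sum d f + U_sum d g"
proof -
  let ?n = "max (Polynomial.degree f) (Polynomial.degree g)"
  have "Polynomial.degree (f + g) \<le> ?n"
    by (rule degree_add_le_max)
  then show ?thesis
    by (simp add: U_sum_bound[of _ ?n] smult_add_left sum.distrib)
qed

lemma U_sum_smult: "U_sum d (Polynomial.smult a g) = Polynomial.smult a (U_sum d g)"
proof -
  have "Polynomial.smult a (sum h A) = (\<Sum>i\<in>A. Polynomial.smult a (h i))" for h :: "nat \<Rightarrow> int poly" and A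
    by (induction A rule: infinite_finite_induct) (auto simp: smult_add_right)
  then show ?thesis
    by (simp add: U_sum_bound[OF degree_smult_le] U_sum_def)
qed

lemma U_sum_pCons: "U_sum d (pCons a g) = Polynomial.smult a (U d) + U_sum (d - 2) g"
  by (subst U_sum_bound[of _ "Suc (Polynomial.degree g)"])
     (simp_all add: degree_pCons_le sum.atMost_Suc_shift U_sum_def algebra_simps del: sum.atMost_Suc)

lemma degree_geom_poly: "Polynomial.degree (geom_poly k) \<le> k"
  unfolding geom_poly_def by (intro degree_sum_le) (auto intro: order.trans[OF degree_monom_le])

lemma coeff_geom_poly: "Polynomial.coeff (geom_poly k) i = (if i \<le> k then 1 else 0)"
  by (simp add: geom_poly_def coeff_sum)

lemma U_sum_geom_poly: "U_sum (j + int k) (geom_poly k) = Q_A1 k * U j"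
  by (simp add: U_sum_bound[OF degree_geom_poly] coeff_geom_poly Q_A1_times_U)

lemma Q_A1_times_U_sum: "Q_A1 k * U_sum d g = U_sum (d + int k) (geom_poly k * g)"
proof (induction g arbitrary: d rule: pCons_induct)
  case 0
  then show ?case by (simp add: U_sum_def)
next
  case (pCons a g)
  then show ?case
    by (simp add: U_sum_add U_sum_smult U_sum_pCons U_sum_geom_poly ring_distribs
        mult_pCons_right algebra_simps)
qed

text \<open>
  Starting from \<open>Q_A1 k = U k\<close> rather than from \<open>1 = U 0\<close> costs one factor of \<open>geom_poly k\<close> less. The
  indices then stop short of \<open>- p - 1\<close> in the application, so that no term \<open>U (- p - 1) = - U (p - 1)\<close>
  interferes.
\<close>

lemma Q_A1_power: "Q_A1 k ^ Suc r = U_sum (int k * int (Suc r)) (geom_poly k ^ r)"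
proof (induction r)
  case 0
  then show ?case by (simp add: U_sum_def)
next
  case (Suc r)
  then have "Q_A1 k ^ Suc (Suc r) = Q_A1 k * U_sum (int k * int (Suc r)) (geom_poly k ^ r)"
    by (metis power_Suc)
  then show ?case
    by (simp only: Q_A1_times_U_sum power_Suc) (simp add: algebra_simps)
qed

text \<open>
  Below degree \<open>k + 1\<close> the truncated geometric series agrees with \<open>1 / (1 - z)\<close>, so this is the
  binomial series of \<open>1 / (1 - z) ^ (r + 1)\<close>.
\<close>

lemma coeff_geom_poly_power:
  assumes "i \<le> k"
  shows "Polynomial.coeff (geom_poly k ^ Suc r) i = int ((r + i) choose i)"
  using assms
proof (induction r arbitrary: i)
  case 0
  then show ?case by (simp add: coeff_geom_poly)
next
  case (Suc r)
  have "Polynomial.coeff (geom_poly k ^ Suc (Suc r)) i = 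
     (\<Sum>l\<le>i. Polynomial.coeff (geom_poly k ^ Suc r) l * Polynomial.coeff (geom_poly k) (i - l))"
    by (simp only: power_Suc2[of _ "Suc r"] coeff_mult)
  also have "\<dots> = (\<Sum>l\<le>i. int ((r + l) choose l))"
    using Suc by (intro sum.cong) (auto simp: coeff_geom_poly)
  also have "\<dots> = int ((Suc r + i) choose i)"
    by (simp add: sum_choose_lower flip: of_nat_sum)
  finally show ?case .
qed

section \<open>The obstruction over a prime field\<close>

lemma sum_Q_A1_cong:
  fixes p j :: nat
  assumes "prime p" "j < 2 * (p - 1)"
  shows "[(\<Sum>x<p. poly (Q_A1 j) (int x)) = (if j = p - 1 then - 1 else 0)] (mod int p)"
proof -
  have "[(\<Sum>x<p. poly (Q_A1 j) (int x)) = - Polynomial.coeff (Q_A1 j) (p - 1)] (mod int p)"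
    using assms by (intro sum_poly_cong_coeff le_less_trans[OF degree_Q_A1])
  also have "[- Polynomial.coeff (Q_A1 j) (p - 1) = - (if j = p - 1 then 1 else 0)] (mod int p)"
    using coeff_Q_A1_prime[OF assms] by (simp only: cong_minus_minus_iff)
  finally show ?thesis by (cases "j = p - 1") simp_all
qed

text \<open>
  An index \<open>j \<le> - 2\<close> in this range reflects to \<open>- j - 2 \<le> p - 2\<close>, so negative indices contribute
  nothing; the bound \<open>- p\<close> is sharp, since \<open>U (- p - 1) = - U (p - 1)\<close>.
\<close>

lemma sum_U_cong:
  fixes p :: nat and j :: int
  assumes p: "prime p" and j: "- int p \<le> j" "j < 2 * (int p - 1)"
  shows "[(\<Sum>x<p. poly (U j) (int x)) = (if j = int p - 1 then - 1 else 0)] (mod int p)"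
proof -
  have "p > 1" using p by (rule prime_gt_1_nat)
  consider "j \<ge> 0" | "j = - 1" | "j \<le> - 2"
    by linarith
  then show ?thesis
  proof cases
    case 1
    have "nat j < 2 * (p - 1)" "nat j = p - 1 \<longleftrightarrow> j = int p - 1"
      using 1 j \<open>p > 1\<close> by auto
    then show ?thesis
      using 1 sum_Q_A1_cong[OF p, of "nat j"] by (simp add: U_def)
  next
    case 2
    then show ?thesis using \<open>p > 1\<close> by (simp add: U_def)
  next
    case 3
    have "nat (- j - 2) < p - 1"
      using 3 j \<open>p > 1\<close> by auto
    then have "[(\<Sum>x<p. poly (Q_A1 (nat (- j - 2))) (int x)) = 0] (mod int p)"
      using sum_Q_A1_cong[OF p, of "nat (- j - 2)"] by simp
    then have "[- (\<Sum>x<p. poly (Q_A1 (nat (- j - 2))) (int x)) = - 0] (mod int p)"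
      by (simp only: cong_minus_minus_iff)
    then show ?thesis
      using 3 \<open>p > 1\<close> by (simp add: U_def sum_negf)
  qed
qed

lemma prime_not_dvd_binomial:
  fixes p :: nat
  assumes "prime p" "i \<le> n" "n < p"
  shows "\<not> p dvd (n choose i)"
proof
  assume "p dvd (n choose i)"
  then have "p dvd fact n"
    using binomial_fact_lemma[OF assms(2)] by (metis dvd_mult)
  with assms show False
    by (simp add: prime_dvd_fact_iff)
qed

lemma sum_Q_A1_power_cong:
  fixes p k r s :: nat
  assumes p: "prime p" and k: "2 * k \<le> p"
    and rk: "(r + 2) * k = p - 1 + 2 * s" and s: "s < k"
  shows "[(\<Sum>x<p. poly (Q_A1 k) (int x) ^ (r + 2)) = - int ((r + s) choose s)] (mod int p)"
proof -
  define d where "d = int k * int (r + 2)"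
  let ?c = "Polynomial.coeff (geom_poly k ^ Suc r)"
  have "p > 1" using p by (rule prime_gt_1_nat)
  have d: "d = int p - 1 + 2 * int s"
    using arg_cong[OF rk, of int] \<open>p > 1\<close> by (simp add: d_def of_nat_diff algebra_simps)
  have deg: "Polynomial.degree (geom_poly k ^ Suc r) \<le> k * Suc r"
    using degree_geom_poly[of k] degree_power_le[of "geom_poly k" "Suc r"]
    by (meson mult_le_mono1 order_trans)
  have "Q_A1 k ^ (r + 2) = (\<Sum>i\<le>k * Suc r. Polynomial.smult (?c i) (U (d - 2 * int i)))"
    using Q_A1_power[of k "Suc r"] U_sum_bound[OF deg] by (simp add: d_def)
  then have "poly (Q_A1 k) x ^ (r + 2) = (\<Sum>i\<le>k * Suc r. ?c i * poly (U (d - 2 * int i)) x)" for x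
    by (metis (mono_tags, lifting) poly_power poly_smult poly_sum sum.cong)
  then have "(\<Sum>x<p. poly (Q_A1 k) (int x) ^ (r + 2)) =
      (\<Sum>i\<le>k * Suc r. ?c i * (\<Sum>x<p. poly (U (d - 2 * int i)) (int x)))"
    by (simp only: sum_distrib_left) (rule sum.swap)
  also have "[\<dots> = (\<Sum>i\<le>k * Suc r. ?c i * (if d - 2 * int i = int p - 1 then - 1 else 0))] (mod int p)"
  proof (intro cong_sum cong_scalar_left sum_U_cong p)
    fix i assume "i \<in> {..k * Suc r}"
    \<comment> \<open>Hence \<open>d - 2 * int i \<ge> 2 * int k - d = 2 * (int k - int s) - (int p - 1)\<close>.\<close>
    then have "int i \<le> d - int k"
      by (simp add: d_def algebra_simps flip: of_nat_mult of_nat_add)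
    then show "- int p \<le> d - 2 * int i"
      using d s by linarith
    show "d - 2 * int i < 2 * (int p - 1)"
      using d s k by (simp add: less_iff_Suc_add) linarith
  qed
  also have "(\<Sum>i\<le>k * Suc r. ?c i * (if d - 2 * int i = int p - 1 then - 1 else 0)) = - ?c s"
  proof -
    have "d - 2 * int i = int p - 1 \<longleftrightarrow> i = s" for i
      using d by auto
    moreover have "s \<le> k * Suc r"
      using s by simp
    ultimately show ?thesis
      by (simp add: if_distrib[of "\<lambda>a. _ * a"] cong: if_cong)
  qed
  also have "?c s = int ((r + s) choose s)"
    using s by (intro coeff_geom_poly_power) simp
  finally show ?thesis .
qed

lemma Q_A1_minus_one: "poly (Q_A1 k) (- 1) = (- 1) ^ k * poly (Q_A1 k) 1"
  by (induction k rule: Q_A1.induct) (simp_all add: algebra_simps)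

lemma sum_power_injective_mod:
  fixes p n :: nat and f :: "int poly"
  assumes p: "p > 0" and inj: "\<And>x y. [poly f x = poly f y] (mod int p) \<Longrightarrow> [x = y] (mod int p)"
  shows "[(\<Sum>x<p. poly f (int x) ^ n) = (\<Sum>x<p. int x ^ n)] (mod int p)"
proof -
  define g where "g x = nat (poly f (int x) mod int p)" for x
  have g: "int (g x) = poly f (int x) mod int p" for x
    using p by (simp add: g_def)
  have "inj_on g {..<p}"
  proof (rule inj_onI)
    fix x y assume xy: "x \<in> {..<p}" "y \<in> {..<p}" "g x = g y"
    then have "[poly f (int x) = poly f (int y)] (mod int p)"
      unfolding cong_def by (metis g)
    then have "[int x = int y] (mod int p)"
      by (rule inj)
    with xy show "x = y"
      by (simp add: cong_int_iff cong_def)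
  qed
  moreover have "g ` {..<p} \<subseteq> {..<p}"
    using p by (auto simp: g_def nat_less_iff)
  ultimately have "bij_betw g {..<p} {..<p}"
    by (simp add: bij_betw_def endo_inj_surj)
  then have "(\<Sum>x<p. int x ^ n) = (\<Sum>x<p. int (g x) ^ n)"
    by (rule sum.reindex_bij_betw[symmetric])
  also have "[\<dots> = (\<Sum>x<p. poly f (int x) ^ n)] (mod int p)"
    by (intro cong_sum cong_pow) (simp add: g cong_def)
  finally show ?thesis by (rule cong_sym)
qed

lemma Q_A1_not_injective_mod:
  fixes p k :: nat
  assumes p: "prime p" "odd p" and k: "k > 1" "2 * k \<le> p"
  shows "\<exists>x y. [poly (Q_A1 k) x = poly (Q_A1 k) y] (mod int p) \<and> \<not> [x = y] (mod int p)"
proof (rule ccontr)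
  assume "\<not> ?thesis"
  then have inj: "[poly (Q_A1 k) x = poly (Q_A1 k) y] (mod int p) \<Longrightarrow> [x = y] (mod int p)" for x y
    by blast
  have p2: "p > 2"
    using p prime_ge_2_nat[of p] by (cases "p = 2") auto
  have "odd k"
  proof
    assume "even k"
    then have "[1 = - 1 :: int] (mod int p)"
      using inj[of 1 "- 1"] by (simp add: Q_A1_minus_one)
    then have "int p dvd int 2"
      by (simp add: cong_iff_dvd_diff)
    then have "p dvd 2"
      by (simp only: int_dvd_int_iff)
    with p2 show False
      using nat_dvd_not_less[of 2 p] by simp
  qed
  with k have k3: "k \<ge> 3"
    by (cases "k = 2") auto
  \<comment> \<open>The exponent \<open>2 * h\<close> of Hermite's criterion: \<open>h\<close> is \<open>e / k\<close> rounded up, and \<open>s\<close> is the excess.\<close>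
  define e where "e = (p - 1) div 2"
  define h where "h = (e + k - 1) div k"
  define s where "s = h * k - e"
  have e: "p - 1 = 2 * e" "e > 0"
    using p p2 by (auto simp: e_def)
  have hk: "h * k + (e + k - 1) mod k = e + k - 1" "(e + k - 1) mod k < k"
    using k by (simp_all add: h_def)
  have s: "h * k = e + s" "s < k"
  proof -
    have "e \<le> h * k" "h * k < e + k"
      using hk k by linarith+
    then show "h * k = e + s" "s < k"
      unfolding s_def by linarith+
  qed
  have "h > 0"
    using s(1) e(2) by (intro Nat.gr0I) simp
  define r where "r = 2 * h - 2"
  have r: "r + 2 = 2 * h"
    using \<open>h > 0\<close> by (simp add: r_def)
  have rk: "(r + 2) * k = p - 1 + 2 * s"
    unfolding r using s e by simp
  \<comment> \<open>Here \<open>k * (r + s) = p - 1 - 2 * k + (k + 2) * s\<close> and \<open>s \<le> k - 1\<close>, which leaves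
      \<open>(k - 1) * (k + 2) < (k - 1) * p + 2 * k + 1\<close>; writing \<open>l = k - 1\<close> avoids subtraction.\<close>
  have "k * (r + s) < k * p"
  proof -
    obtain l where l: "k = Suc l"
      using k by (cases k) auto
    have "(l + 3) * s \<le> (l + 3) * l"
      using s l by (intro mult_le_mono2) simp
    moreover have "l * (2 * l + 2) \<le> l * p"
      using k l by (intro mult_le_mono2) simp
    moreover have "k * (r + s) + 2 * l + 2 = p - 1 + (l + 3) * s"
      using rk unfolding l by (simp add: algebra_simps)
    moreover have "k * p = p + l * p"
      by (simp add: l)
    moreover have "l \<le> l * l"
      by simp
    ultimately show ?thesis
      using p2 by (simp add: algebra_simps)
  qed
  then have rs: "r + s < p"
    by simp
  have "(r + 2) * 3 \<le> 2 * e + 2 * s"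
    using mult_le_mono2[OF k3, of "r + 2"] unfolding rk e(1) .
  moreover have "p = 2 * e + 1"
    using e(1) p2 by linarith
  ultimately have "r + 2 < p - 1"
    using s(2) k(2) e(2) by presburger
  then have "[(\<Sum>x<p. int x ^ (r + 2)) = 0] (mod int p)"
    unfolding cong_0_iff by (rule power_sum_cong_0[OF p(1)])
  moreover have "[(\<Sum>x<p. poly (Q_A1 k) (int x) ^ (r + 2)) = (\<Sum>x<p. int x ^ (r + 2))] (mod int p)"
    by (rule sum_power_injective_mod[OF _ inj]) (use p2 in simp_all)
  moreover have "[(\<Sum>x<p. poly (Q_A1 k) (int x) ^ (r + 2)) = - int ((r + s) choose s)] (mod int p)"
    using p(1) k(2) rk s(2) by (rule sum_Q_A1_power_cong)
  ultimately have "[- int ((r + s) choose s) = 0] (mod int p)"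
    by (meson cong_sym cong_trans)
  then have "p dvd ((r + s) choose s)"
    by (simp add: cong_0_iff)
  with prime_not_dvd_binomial[OF p(1) _ rs, of s] show False
    by simp
qed

section \<open>Restriction to the prime field\<close>

context ring
begin

abbreviation of_integer :: "int \<Rightarrow> 'a" where
  "of_integer c \<equiv> [c] \<cdot> \<one>"

lemma of_integer_add: "of_integer (c + d) = of_integer c \<oplus> of_integer d"
  by (rule add.int_pow_mult) simp

lemma of_integer_mult: "of_integer (c * d) = of_integer c \<otimes> of_integer d"
  using add_pow_ldistr_int[of \<one> "of_integer d" c] add.int_pow_pow[of \<one> c d]
  by (simp add: mult.commute)

lemma of_integer_power: "of_integer (c ^ n) = of_integer c [^] n"
  by (induction n) (simp_all add: add_pow_int_ge of_integer_mult power_Suc2 del: power_Suc)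

lemma of_integer_sum:
  "of_integer (sum g A) = (\<Oplus>i\<in>A. of_integer (g i))" if "finite A"
  using that by (induction A rule: finite_induct) (simp_all add: add_pow_int_ge of_integer_add)

lemma induced_map_of_integer: "induced_map R f (of_integer c) = of_integer (poly f c)"
  unfolding induced_map_def poly_altdef
  by (simp add: of_integer_sum of_integer_mult of_integer_power)

end

text \<open>
  By Lagrange's theorem in the additive group \<open>p ^ m\<close> is zero in the field, hence so is \<open>p\<close>;
  an integer prime to \<open>p\<close> then cannot vanish as well, by Bezout.
\<close>

lemma (in field) of_integer_eq_0_iff:
  fixes p m :: nat
  assumes p: "prime p" and card: "card (carrier R) = p ^ m"
  shows "of_integer c = \<zero> \<longleftrightarrow> int p dvd c"
proof -
  have pow_zero: "x [^] n = \<zero> \<Longrightarrow> x = \<zero>" if "x \<in> carrier R" for x and n :: nat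
    using that
  proof (induction n)
    case 0
    then show ?case by simp
  next
    case (Suc n)
    then show ?case
      using integral[of "x [^] n" x] by auto
  qed
  have "of_integer (int p ^ m) = \<zero>"
    using add.pow_order_eq_1[of \<one>] card
    by (simp add: order_def add_pow_int_ge nat_power_eq)
  then have char: "of_integer (int p) = \<zero>"
    unfolding of_integer_power by (rule pow_zero[rotated]) simp
  show ?thesis
  proof
    assume "int p dvd c"
    then obtain d where "c = int p * d"
      unfolding dvd_def by blast
    then have "of_integer c = of_integer (int p) \<otimes> of_integer d"
      by (simp only: of_integer_mult)
    then show "of_integer c = \<zero>"
      unfolding char by simp
  next
    assume c: "of_integer c = \<zero>"
    show "int p dvd c"
    proof (rule ccontr)
      assume "\<not> int p dvd c"
      then have "coprime (int p) c"
        using p by (simp add: prime_imp_coprime)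
      then obtain a b where "a * int p + b * c = 1"
        using bezout_int[of "int p" c] by auto
      then have "of_integer 1 = of_integer a \<otimes> of_integer (int p) \<oplus> of_integer b \<otimes> of_integer c"
        by (metis of_integer_add of_integer_mult)
      then show False
        unfolding char c by simp
    qed
  qed
qed

lemma (in field) induces_permutation_imp_injective_mod:
  fixes p m :: nat
  assumes p: "prime p" and card: "card (carrier R) = p ^ m"
    and perm: "induces_permutation R f" and xy: "[poly f x = poly f y] (mod int p)"
  shows "[x = y] (mod int p)"
proof -
  have eq_iff: "of_integer c = of_integer d \<longleftrightarrow> [c = d] (mod int p)" for c d
  proof -
    have "of_integer c = of_integer (c - d) \<oplus> of_integer d"
      using of_integer_add[of "c - d" d] by simp
    then have "of_integer c = of_integer d \<longleftrightarrow> of_integer (c - d) = \<zero>"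
      by simp
    then show ?thesis
      by (simp add: of_integer_eq_0_iff[OF p card] cong_iff_dvd_diff)
  qed
  have "induced_map R f (of_integer x) = induced_map R f (of_integer y)"
    using xy by (simp only: induced_map_of_integer eq_iff)
  then have "of_integer x = of_integer y"
    using perm by (auto simp: induces_permutation_def bij_betw_def dest: inj_onD)
  then show ?thesis
    by (simp only: eq_iff)
qed

lemma Q_A1_permutation_imp_small_prime:
  fixes F :: "('a, 'b) ring_scheme" and p m k :: nat
  assumes "prime p" "odd p" "k > 1"
    and "field F" "card (carrier F) = p ^ m" "induces_permutation F (Q_A1 k)"
  shows "p < 2 * k"
  using Q_A1_not_injective_mod[of p k] field.induces_permutation_imp_injective_mod[of F p m "Q_A1 k"]
    assms by (meson not_le)

theorem theorem16:
  fixes k :: nat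
  assumes "k > 1"
  shows "(\<forall>(F :: ('a, 'b) ring_scheme) (p :: nat) (q :: nat) (m :: nat).
            prime p \<and> odd p \<and> m > 0 \<and> q = p ^ m
            \<and> field F \<and> finite (carrier F) \<and> card (carrier F) = q
            \<and> induces_permutation F (Q_A1 k)
            \<longrightarrow> real p \<le> ((real k + 1) / 2) ^ 2 + 1)
         \<and> \<not> arithmetically_exceptional (Q_A1 k)"
proof (intro conjI allI impI)
  fix F :: "('a, 'b) ring_scheme" and p q m :: nat
  assume "prime p \<and> odd p \<and> m > 0 \<and> q = p ^ m
            \<and> field F \<and> finite (carrier F) \<and> card (carrier F) = q
            \<and> induces_permutation F (Q_A1 k)"
  then have p: "prime p" "odd p" and F: "field F" "card (carrier F) = p ^ m"
    and perm: "induces_permutation F (Q_A1 k)"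
    by simp_all
  have small: "p < 2 * k"
    using p assms F perm by (rule Q_A1_permutation_imp_small_prime)
  \<comment> \<open>\<open>((k + 1) / 2)\<^sup>2 + 1 - (2 * k - 1) = ((k - 3) / 2)\<^sup>2\<close>\<close>
  show "real p \<le> ((real k + 1) / 2) ^ 2 + 1"
  proof -
    have "real p \<le> 2 * real k - 1"
      using small by linarith
    moreover have "0 \<le> (real k - 3)\<^sup>2"
      by simp
    ultimately show ?thesis
      by (simp add: power2_eq_square field_simps)
  qed
next
  have "{p. prime p \<and> induces_permutation (residue_ring (int p)) (Q_A1 k)} \<subseteq> {..2 * k}"
  proof
    fix p assume "p \<in> {p. prime p \<and> induces_permutation (residue_ring (int p)) (Q_A1 k)}"
    then have p: "prime p" and perm: "induces_permutation (residue_ring (int p)) (Q_A1 k)"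
      by simp_all
    interpret residues_prime p "residue_ring (int p)"
      using p by unfold_locales
    have "card (carrier (residue_ring (int p))) = p ^ 1"
      by (simp add: res_carrier_eq)
    then have "odd p \<Longrightarrow> p < 2 * k"
      using p assms is_field perm by (intro Q_A1_permutation_imp_small_prime)
    moreover have "even p \<Longrightarrow> p = 2"
      using p primes_dvd_imp_eq two_is_prime_nat by blast
    ultimately show "p \<in> {..2 * k}"
      using assms by (cases "even p") auto
  qed
  then show "\<not> arithmetically_exceptional (Q_A1 k)"
    unfolding arithmetically_exceptional_def by (auto dest: finite_subset)
qed

end
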